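(* Let $G$ be a connected graph containing neither $C_4$ nor $C_5$ as a subgraph. The following are equivalent: (1) $G\in\mathbf{W_2}$; (2) $G\cong K_2$, or there exists a partition $\{T_1,\dots,T_k\}$ of $V(G)$ such that for each $1\le i\le k$, $G[T_i]$ is a triangle containing at least $2$ simplicial vertices of $G$.
   Context: Graphs are finite, simple, undirected. A vertex $v$ is simplicial if $N[v]=N(v)\cup\{v\}$ is a clique. A set is independent if its vertices are pairwise nonadjacent; maximum if no independent set is larger. $G\in\mathbf{W_2}$ if every two disjoint independent sets of $G$ are contained in two disjoint maximum independent sets of $G$. *)

theory Defs
  imports "Graph_Theory.Graph_Theory" "HOL-Library.Disjoint_Sets"
begin

text \<open>
  A finite simple undirected graph is a digraph satisfying the locale predicate \<^const>\<open>graph\<close> of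
  Graph_Theory: finite, loop-free, without parallel arcs, and with a symmetric adjacency relation
  \<^const>\<open>arcs_ends\<close>, so that an undirected edge is a pair of opposite arcs.
\<close>

definition neighborhood :: "('a, 'b) pre_digraph \<Rightarrow> 'a \<Rightarrow> 'a set" where
  "neighborhood G v = {u \<in> verts G. v \<rightarrow>\<^bsub>G\<^esub> u}"

definition closed_neighborhood :: "('a, 'b) pre_digraph \<Rightarrow> 'a \<Rightarrow> 'a set" where
  "closed_neighborhood G v = neighborhood G v \<union> {v}"

definition clique :: "('a, 'b) pre_digraph \<Rightarrow> 'a set \<Rightarrow> bool" where
  "clique G S \<longleftrightarrow> S \<subseteq> verts G \<and> (\<forall>u\<in>S. \<forall>v\<in>S. u \<noteq> v \<longrightarrow> u \<rightarrow>\<^bsub>G\<^esub> v)"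

definition simplicial :: "('a, 'b) pre_digraph \<Rightarrow> 'a \<Rightarrow> bool" where
  "simplicial G v \<longleftrightarrow> v \<in> verts G \<and> clique G (closed_neighborhood G v)"

definition independent_set :: "('a, 'b) pre_digraph \<Rightarrow> 'a set \<Rightarrow> bool" where
  "independent_set G S \<longleftrightarrow> S \<subseteq> verts G \<and> (\<forall>u\<in>S. \<forall>v\<in>S. \<not> u \<rightarrow>\<^bsub>G\<^esub> v)"

definition maximum_independent_set :: "('a, 'b) pre_digraph \<Rightarrow> 'a set \<Rightarrow> bool" where
  "maximum_independent_set G S \<longleftrightarrow>
    independent_set G S \<and> (\<forall>T. independent_set G T \<longrightarrow> card T \<le> card S)"

definition W2 :: "('a, 'b) pre_digraph \<Rightarrow> bool" where
  "W2 G \<longleftrightarrow> (\<forall>A B. independent_set G A \<and> independent_set G B \<and> A \<inter> B = {} \<longrightarrow>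
    (\<exists>S T. maximum_independent_set G S \<and> maximum_independent_set G T \<and> S \<inter> T = {} \<and>
      A \<subseteq> S \<and> B \<subseteq> T))"

text \<open>
  In the style of \<^const>\<open>complete_digraph\<close>: \<open>cycle_graph n H\<close> states that \<open>H\<close> is (isomorphic to) the
  cycle \<open>C\<^sub>n\<close>, with \<open>f\<close> enumerating its vertices in cyclic order. Meaningful for \<open>n \<ge> 3\<close>.
\<close>

definition cycle_graph :: "nat \<Rightarrow> ('a, 'b) pre_digraph \<Rightarrow> bool" where
  "cycle_graph n H \<longleftrightarrow> graph H \<and>
    (\<exists>f. bij_betw f {..<n} (verts H) \<and>
      arcs_ends H = (\<Union>i<n. {(f i, f (Suc i mod n)), (f (Suc i mod n), f i)}))"

text \<open>Not necessarily as an induced subgraph.\<close>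

definition contains_cycle :: "('a, 'b) pre_digraph \<Rightarrow> nat \<Rightarrow> bool" where
  "contains_cycle G n \<longleftrightarrow> (\<exists>H. subgraph H G \<and> cycle_graph n H)"

end

theory Submission
  imports Defs
begin

text \<open>
  If \<open>G\<close> is in \<open>W\<^sub>2\<close>, then no independent set avoiding \<open>N[v]\<close> dominates \<open>N(v)\<close>. Suppose every
  \<open>u \<in> N(v)\<close> had a neighbour \<open>w u\<close> outside \<open>N[v]\<close>. As there is no \<open>C\<^sub>5\<close>, the vertices \<open>w u\<close> form
  an independent set, which dominates \<open>N(v)\<close>, a contradiction. So some \<open>u \<in> N(v)\<close> has
  \<open>N[u] \<subseteq> N[v]\<close>, and as there is no \<open>C\<^sub>4\<close> it is simplicial. Hence the sets \<open>N[s]\<close> with \<open>s\<close>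
  simplicial cover \<open>G\<close>. They are disjoint, because exchanging \<open>v\<close> for two nonadjacent simplicial
  neighbours would enlarge a maximum independent set containing \<open>v\<close>. A vertex of degree one spans
  a \<open>K\<^sub>2\<close> component, so apart from \<open>K\<^sub>2\<close> the sets \<open>N[s]\<close> are triangles, and the first argument
  applied to \<open>s\<close> itself yields the second simplicial vertex.

  Conversely, two disjoint independent sets are enlarged, in each triangle that they miss, by
  simplicial vertices of that triangle, of which there are enough to keep the two sets disjoint.
\<close>

section \<open>Graphs, cliques and cycles\<close>

lemma (in wf_digraph) arcs_ends_induce:
  "arcs_ends (G \<restriction> T) = arcs_ends G \<inter> T \<times> T"
  by (auto simp: arcs_ends_conv)

lemma (in graph) adj_sym: "u \<rightarrow>\<^bsub>G\<^esub> v \<Longrightarrow> v \<rightarrow>\<^bsub>G\<^esub> u"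
  using sym_arcs by (rule arcs_ends_symmetric)

lemma (in graph) adj_vertsD: "u \<rightarrow>\<^bsub>G\<^esub> v \<Longrightarrow> u \<in> verts G \<and> v \<in> verts G"
  using adj_in_verts by blast

lemma (in graph) mem_neighborhood: "u \<in> neighborhood G v \<longleftrightarrow> v \<rightarrow>\<^bsub>G\<^esub> u"
  using adj_vertsD by (auto simp: neighborhood_def)

lemma (in graph) mem_closed_neighborhood:
  "u \<in> closed_neighborhood G v \<longleftrightarrow> u = v \<or> v \<rightarrow>\<^bsub>G\<^esub> u"
  by (auto simp: closed_neighborhood_def mem_neighborhood)

lemma (in graph) closed_neighborhood_subset_verts:
  "v \<in> verts G \<Longrightarrow> closed_neighborhood G v \<subseteq> verts G"
  using adj_vertsD by (auto simp: mem_closed_neighborhood)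

lemma (in graph) induce_graph: "T \<subseteq> verts G \<Longrightarrow> graph (G \<restriction> T)"
proof -
  assume T: "T \<subseteq> verts G"
  have "symmetric (G \<restriction> T)"
    using adj_sym by (auto simp: symmetric_def arcs_ends_induce intro!: symI)
  then show ?thesis
    using T no_loops no_multi_arcs
    by unfold_locales (auto intro: finite_subset simp: arc_to_ends_def)
qed

text \<open>Lets the triangles of the partition be treated as cliques of \<open>G\<close> itself,
  without passing to induced subgraphs.\<close>

lemma (in graph) complete_digraph_induce_iff:
  assumes "T \<subseteq> verts G"
  shows "complete_digraph n (G \<restriction> T) \<longleftrightarrow> clique G T \<and> card T = n"
  using assms induce_graph[OF assms] adj_not_same
  by (auto simp: complete_digraph_def clique_def arcs_ends_induce)

lemma (in graph) complete_digraph_iff: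
  "complete_digraph n G \<longleftrightarrow> clique G (verts G) \<and> card (verts G) = n"
  using graph_axioms adj_not_same adj_vertsD
  by (auto simp: complete_digraph_def clique_def)

text \<open>Chords among the listed vertices do no harm: the subgraph keeps only the arcs of
  \<open>G\<close> that join cyclically consecutive entries, in both directions.\<close>

lemma (in graph) contains_cycleI:
  assumes dist: "distinct xs" and len: "length xs = n"
    and adj: "\<And>i. i < n \<Longrightarrow> xs ! i \<rightarrow>\<^bsub>G\<^esub> xs ! (Suc i mod n)"
  shows "contains_cycle G n"
proof -
  define E where "E = (\<Union>i<n. {(xs ! i, xs ! (Suc i mod n)), (xs ! (Suc i mod n), xs ! i)})"
  define H where "H = \<lparr>verts = set xs, arcs = {e \<in> arcs G. (tail G e, head G e) \<in> E},
    tail = tail G, head = head G\<rparr>"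
  have "xs ! i \<in> set xs" "xs ! (Suc i mod n) \<in> set xs" if "i < n" for i
    using that len by simp_all
  then have E_set: "E \<subseteq> set xs \<times> set xs"
    by (auto simp: E_def)
  have E_arcs: "E \<subseteq> arcs_ends G"
    using adj adj_sym by (auto simp: E_def)
  have set_verts: "set xs \<subseteq> verts G"
    using adj adj_vertsD len by (metis in_set_conv_nth subsetI)
  have ends: "arcs_ends H = E"
    using E_arcs by (auto simp: H_def arcs_ends_conv)
  have sym: "symmetric H"
    unfolding symmetric_def ends by (auto simp: E_def sym_def)
  have wf: "wf_digraph H"
    using E_set by unfold_locales (auto simp: H_def)
  have "graph H"
    using wf sym no_loops no_multi_arcs
    unfolding graph_def digraph_def pseudo_graph_def fin_digraph_def fin_digraph_axioms_def
      loopfree_digraph_def loopfree_digraph_axioms_def nomulti_digraph_def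
      nomulti_digraph_axioms_def sym_digraph_def sym_digraph_axioms_def
    by (auto simp: H_def arc_to_ends_def)
  moreover have "bij_betw ((!) xs) {..<n} (verts H)"
    using bij_betw_nth[OF dist] len by (simp add: H_def)
  ultimately have "cycle_graph n H"
    unfolding cycle_graph_def using ends E_def by blast
  moreover have "subgraph H G"
    unfolding subgraph_def compatible_def using wf wf_digraph set_verts by (auto simp: H_def)
  ultimately show ?thesis
    unfolding contains_cycle_def by blast
qed

lemma (in graph) no_C4:
  assumes "\<not> contains_cycle G 4" "distinct [a, b, c, d]"
    "a \<rightarrow>\<^bsub>G\<^esub> b" "b \<rightarrow>\<^bsub>G\<^esub> c" "c \<rightarrow>\<^bsub>G\<^esub> d" "d \<rightarrow>\<^bsub>G\<^esub> a"
  shows False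
proof -
  have "[a, b, c, d] ! i \<rightarrow>\<^bsub>G\<^esub> [a, b, c, d] ! (Suc i mod 4)" if "i < 4" for i
  proof -
    have "i = 0 \<or> i = 1 \<or> i = 2 \<or> i = 3"
      using that by linarith
    then show ?thesis
      using assms(3-) by (elim disjE) simp_all
  qed
  then show False
    using contains_cycleI[OF assms(2), of 4] assms(1) by simp
qed

lemma (in graph) no_C5:
  assumes "\<not> contains_cycle G 5" "distinct [a, b, c, d, e]"
    "a \<rightarrow>\<^bsub>G\<^esub> b" "b \<rightarrow>\<^bsub>G\<^esub> c" "c \<rightarrow>\<^bsub>G\<^esub> d" "d \<rightarrow>\<^bsub>G\<^esub> e" "e \<rightarrow>\<^bsub>G\<^esub> a"
  shows False
proof -
  have "[a, b, c, d, e] ! i \<rightarrow>\<^bsub>G\<^esub> [a, b, c, d, e] ! (Suc i mod 5)" if "i < 5" for i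
  proof -
    have "i = 0 \<or> i = 1 \<or> i = 2 \<or> i = 3 \<or> i = 4"
      using that by linarith
    then show ?thesis
      using assms(3-) by (elim disjE) simp_all
  qed
  then show False
    using contains_cycleI[OF assms(2), of 5] assms(1) by simp
qed

section \<open>Independent sets and cliques\<close>

lemma (in graph) independent_set_finite: "independent_set G S \<Longrightarrow> finite S"
  unfolding independent_set_def using finite_verts finite_subset by blast

lemma (in graph) independent_set_singleton: "v \<in> verts G \<Longrightarrow> independent_set G {v}"
  unfolding independent_set_def using adj_not_same by blast

lemma independent_set_empty: "independent_set G {}"
  by (simp add: independent_set_def)

text \<open>Any four vertices of a clique, in any order, form a 4-cycle.\<close>

lemma (in graph) clique_card_le_3:
  assumes "\<not> contains_cycle G 4" "clique G K"
  shows "card K \<le> 3"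
proof (rule ccontr)
  assume "\<not> card K \<le> 3"
  then obtain L where "L \<subseteq> K" "card L = 4"
    using obtain_subset_with_card_n[of 4 K] by auto
  then obtain a b c d where "L = {a, b, c, d}" "distinct [a, b, c, d]"
    by (auto simp: numeral_eq_Suc card_Suc_eq)
  then show False
    using no_C4[OF assms(1), of a b c d] assms(2) \<open>L \<subseteq> K\<close> by (auto simp: clique_def)
qed

lemma simplicial_adjI:
  assumes "simplicial G s" "x \<in> closed_neighborhood G s" "y \<in> closed_neighborhood G s" "x \<noteq> y"
  shows "x \<rightarrow>\<^bsub>G\<^esub> y"
  using assms by (simp add: simplicial_def clique_def)

section \<open>Simplicial vertices of graphs in \<open>W\<^sub>2\<close>\<close>

text \<open>Extend \<open>{v}\<close> and \<open>S\<close> to disjoint maximum independent sets. The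
  one containing \<open>S\<close> misses \<open>v\<close> and cannot be enlarged by
  \<open>v\<close>, so it contains a neighbour of \<open>v\<close>, which is then adjacent to
  nothing in \<open>S\<close>.\<close>

lemma (in graph) W2_not_dominated:
  assumes "W2 G" "v \<in> verts G" "independent_set G S" "S \<inter> closed_neighborhood G v = {}"
  obtains u where "v \<rightarrow>\<^bsub>G\<^esub> u" "neighborhood G u \<inter> S = {}"
proof -
  have "{v} \<inter> S = {}"
    using assms(4) by (auto simp: mem_closed_neighborhood)
  then obtain M T where T: "maximum_independent_set G T" "M \<inter> T = {}" "{v} \<subseteq> M" "S \<subseteq> T"
    using assms independent_set_singleton unfolding W2_def by metis
  then have ind: "independent_set G T" and "v \<notin> T"
    by (auto simp: maximum_independent_set_def)
  have "card (insert v T) = Suc (card T)"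
    using independent_set_finite[OF ind] \<open>v \<notin> T\<close> by simp
  then have "\<not> independent_set G (insert v T)"
    using T(1) unfolding maximum_independent_set_def by (metis Suc_n_not_le_n)
  then obtain u where u: "u \<in> T" "v \<rightarrow>\<^bsub>G\<^esub> u"
    using ind assms(2) adj_sym adj_not_same unfolding independent_set_def by blast
  moreover have "neighborhood G u \<inter> S = {}"
    using u T(4) ind by (auto simp: mem_neighborhood independent_set_def)
  ultimately show thesis
    using that by blast
qed

lemma (in graph) W2_closed_neighborhood_subset:
  assumes "W2 G" "\<not> contains_cycle G 5" "v \<in> verts G"
  obtains u where "v \<rightarrow>\<^bsub>G\<^esub> u" "closed_neighborhood G u \<subseteq> closed_neighborhood G v"
proof (rule ccontr)
  assume "\<not> thesis"
  then have "\<exists>w. u \<rightarrow>\<^bsub>G\<^esub> w \<and> w \<notin> closed_neighborhood G v" if "v \<rightarrow>\<^bsub>G\<^esub> u" for u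
    using that \<open>\<And>u. v \<rightarrow>\<^bsub>G\<^esub> u \<Longrightarrow> closed_neighborhood G u \<subseteq> closed_neighborhood G v \<Longrightarrow> thesis\<close>
    unfolding mem_closed_neighborhood subset_iff by blast
  then obtain w where w: "\<And>u. v \<rightarrow>\<^bsub>G\<^esub> u \<Longrightarrow> u \<rightarrow>\<^bsub>G\<^esub> w u"
    "\<And>u. v \<rightarrow>\<^bsub>G\<^esub> u \<Longrightarrow> w u \<notin> closed_neighborhood G v"
    by metis
  let ?S = "w ` neighborhood G v"
  have "\<not> w u \<rightarrow>\<^bsub>G\<^esub> w u'" if u: "v \<rightarrow>\<^bsub>G\<^esub> u" "v \<rightarrow>\<^bsub>G\<^esub> u'" for u u'
  proof
    assume *: "w u \<rightarrow>\<^bsub>G\<^esub> w u'"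
    \<comment> \<open>The vertices \<open>w u\<close> and \<open>w u'\<close> lie outside
      \<open>N[v]\<close>, hence differ from \<open>v\<close>, \<open>u\<close>, \<open>u'\<close>.
      If \<open>u = u'\<close>, the assumed arc would be a loop.\<close>
    then have "distinct [v, u, w u, w u', u']"
      using w[OF u(1)] w[OF u(2)] u adj_not_same by (auto simp: mem_closed_neighborhood)
    then show False
      using no_C5[OF assms(2)] u w(1) * adj_sym by blast
  qed
  then have "independent_set G ?S"
    using w(1)[THEN adj_vertsD] by (auto simp: independent_set_def mem_neighborhood)
  moreover have "?S \<inter> closed_neighborhood G v = {}"
    using w(2) by (auto simp: mem_neighborhood)
  ultimately obtain u where "v \<rightarrow>\<^bsub>G\<^esub> u" "neighborhood G u \<inter> ?S = {}"
    using W2_not_dominated[OF assms(1,3)] by blast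
  moreover from this(1) have "w u \<in> neighborhood G u" "w u \<in> ?S"
    using w(1) by (auto simp: mem_neighborhood)
  ultimately show False
    by blast
qed

text \<open>Every neighbour of \<open>u\<close> other than \<open>v\<close> is also adjacent to
  \<open>v\<close>. Two such vertices \<open>x\<close>, \<open>y\<close> would close the 4-cycle
  \<open>u\<close>, \<open>x\<close>, \<open>v\<close>, \<open>y\<close>, so \<open>u\<close> has at
  most one neighbour besides \<open>v\<close>.\<close>

lemma (in graph) simplicial_if_closed_neighborhood_subset:
  assumes "\<not> contains_cycle G 4" "v \<rightarrow>\<^bsub>G\<^esub> u"
    "closed_neighborhood G u \<subseteq> closed_neighborhood G v"
  shows "simplicial G u"
proof -
  have "x \<rightarrow>\<^bsub>G\<^esub> y"
    if xy: "x \<in> closed_neighborhood G u" "y \<in> closed_neighborhood G u" "x \<noteq> y" for x y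
  proof (cases "x \<in> {u, v} \<or> y \<in> {u, v}")
    case True
    have "x \<in> closed_neighborhood G v" "y \<in> closed_neighborhood G v"
      using xy assms(3) by auto
    with True xy show ?thesis
      by (auto simp: mem_closed_neighborhood intro: adj_sym)
  next
    case False
    then have "u \<rightarrow>\<^bsub>G\<^esub> x" "x \<rightarrow>\<^bsub>G\<^esub> v" "v \<rightarrow>\<^bsub>G\<^esub> y" "y \<rightarrow>\<^bsub>G\<^esub> u"
      using xy(1,2) assms(3) adj_sym by (auto simp: mem_closed_neighborhood)
    moreover have "distinct [u, x, v, y]"
      using False xy(3) assms(2) adj_not_same by auto
    ultimately show ?thesis
      using no_C4[OF assms(1)] by blast
  qed
  then show ?thesis
    using assms(2) adj_vertsD[of v u] closed_neighborhood_subset_verts[of u]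
    by (auto simp: simplicial_def clique_def)
qed

text \<open>Used twice: for arbitrary \<open>v\<close> it gives the covering by sets
  \<open>N[u]\<close>, and for simplicial \<open>v\<close> it gives a second simplicial vertex,
  since \<open>u\<close> differs from \<open>v\<close>.\<close>

lemma (in graph) W2_simplicial_neighbour:
  assumes "W2 G" "\<not> contains_cycle G 4" "\<not> contains_cycle G 5" "v \<in> verts G"
  obtains u where "v \<rightarrow>\<^bsub>G\<^esub> u" "simplicial G u"
proof -
  obtain u where "v \<rightarrow>\<^bsub>G\<^esub> u" "closed_neighborhood G u \<subseteq> closed_neighborhood G v"
    by (rule W2_closed_neighborhood_subset[OF assms(1,3,4)])
  then show thesis
    using that simplicial_if_closed_neighborhood_subset[OF assms(2)] by metis
qed

text \<open>The clique around a simplicial vertex lies in the closed neighbourhood of each of its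
  members; here this applies in both directions.\<close>

lemma (in graph) simplicial_closed_neighborhood_eq:
  assumes "simplicial G s" "simplicial G t" "s \<rightarrow>\<^bsub>G\<^esub> t"
  shows "closed_neighborhood G s = closed_neighborhood G t"
proof -
  have "closed_neighborhood G x \<subseteq> closed_neighborhood G y"
    if "simplicial G x" "x \<rightarrow>\<^bsub>G\<^esub> y" for x y
  proof
    fix z assume "z \<in> closed_neighborhood G x"
    moreover have "y \<in> closed_neighborhood G x"
      using that(2) by (simp add: mem_closed_neighborhood)
    ultimately have "z = y \<or> y \<rightarrow>\<^bsub>G\<^esub> z"
      using simplicial_adjI[OF that(1)] by blast
    then show "z \<in> closed_neighborhood G y"
      by (simp add: mem_closed_neighborhood)
  qed
  then show ?thesis
    using assms adj_sym by blast
qed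

lemma (in graph) W2_simplicial_neighbours_adjacent:
  assumes W2: "W2 G" and s: "simplicial G s" and t: "simplicial G t"
    and adj: "v \<rightarrow>\<^bsub>G\<^esub> s" "v \<rightarrow>\<^bsub>G\<^esub> t" and "s \<noteq> t"
  shows "s \<rightarrow>\<^bsub>G\<^esub> t"
proof (rule ccontr)
  assume st: "\<not> s \<rightarrow>\<^bsub>G\<^esub> t"
  have "independent_set G {v}"
    using adj adj_vertsD independent_set_singleton by blast
  then obtain M where M: "maximum_independent_set G M" "v \<in> M"
    using W2 independent_set_empty unfolding W2_def by (metis inf_bot_right insert_subset)
  then have ind: "independent_set G M"
    by (simp add: maximum_independent_set_def)
  \<comment> \<open>Both \<open>v\<close> and \<open>m\<close> lie in the clique
    \<open>N[x]\<close>, so if distinct they would be adjacent members of the independent set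
    \<open>M\<close>.\<close>
  have only_v: "m = v" if "x \<in> {s, t}" "x \<rightarrow>\<^bsub>G\<^esub> m" "m \<in> M" for x m
  proof (rule ccontr)
    assume "m \<noteq> v"
    have "v \<in> closed_neighborhood G x" "m \<in> closed_neighborhood G x"
      using that adj adj_sym by (auto simp: mem_closed_neighborhood)
    then have "v \<rightarrow>\<^bsub>G\<^esub> m"
      using simplicial_adjI[of G x v m] s t that(1) \<open>m \<noteq> v\<close> by auto
    then show False
      using ind M(2) that(3) by (auto simp: independent_set_def)
  qed
  have notin: "s \<notin> M" "t \<notin> M"
    using ind M(2) adj by (auto simp: independent_set_def)
  \<comment> \<open>The exchange: \<open>v\<close> leaves, two vertices from outside
    \<open>M\<close> enter. By \<open>only_v\<close>, removing \<open>v\<close> removes every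
    conflict with \<open>s\<close> and \<open>t\<close>.\<close>
  let ?M = "insert s (insert t (M - {v}))"
  have no_arc: "\<not> x \<rightarrow>\<^bsub>G\<^esub> y" if x: "x \<in> {s, t}" and y: "y \<in> ?M" for x y
  proof
    assume xy: "x \<rightarrow>\<^bsub>G\<^esub> y"
    show False
    proof (cases "y \<in> {s, t}")
      case True
      then show False
        using x xy st adj_sym[OF xy] adj_not_same by auto
    next
      case False
      then show False
        using only_v[OF x xy] y by auto
    qed
  qed
  have "\<not> x \<rightarrow>\<^bsub>G\<^esub> y" if xy: "x \<in> ?M" "y \<in> ?M" for x y
  proof (cases "x \<in> {s, t} \<or> y \<in> {s, t}")
    case True
    then show ?thesis
      using no_arc[of x y] no_arc[of y x] xy adj_sym[of x y] by blast
  next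
    case False
    then show ?thesis
      using xy ind by (auto simp: independent_set_def)
  qed
  moreover have "?M \<subseteq> verts G"
    using ind s t by (auto simp: independent_set_def simplicial_def)
  ultimately have "independent_set G ?M"
    by (simp add: independent_set_def)
  moreover have "card ?M = Suc (card M)"
    using notin \<open>s \<noteq> t\<close> independent_set_finite[OF ind]
      card_Suc_Diff1[OF independent_set_finite[OF ind] M(2)] by (simp del: card_Diff_insert)
  ultimately show False
    using M(1) unfolding maximum_independent_set_def by (metis Suc_n_not_le_n)
qed

text \<open>A further neighbour \<open>w\<close> of \<open>v\<close> would make \<open>{w}\<close>
  an independent set that avoids \<open>N[u]\<close> and dominates \<open>v\<close>, the only
  neighbour of \<open>u\<close>.\<close>

lemma (in graph) W2_leaf:
  assumes "W2 G" "neighborhood G u = {v}"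
  shows "neighborhood G v = {u}"
proof -
  have uv: "u \<rightarrow>\<^bsub>G\<^esub> v"
    using assms(2) mem_neighborhood by auto
  have "w = u" if w: "v \<rightarrow>\<^bsub>G\<^esub> w" for w
  proof (rule ccontr)
    assume "w \<noteq> u"
    then have "{w} \<inter> closed_neighborhood G u = {}"
      using w adj_not_same assms(2) by (auto simp: closed_neighborhood_def)
    moreover have "u \<in> verts G" "independent_set G {w}"
      using uv w adj_vertsD independent_set_singleton by blast+
    ultimately obtain x where "u \<rightarrow>\<^bsub>G\<^esub> x" "neighborhood G x \<inter> {w} = {}"
      using W2_not_dominated[OF assms(1)] by metis
    moreover have "x = v"
      using \<open>u \<rightarrow>\<^bsub>G\<^esub> x\<close> assms(2) mem_neighborhood[of x u] by simp
    ultimately show False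
      using w by (simp add: mem_neighborhood)
  qed
  then show ?thesis
    using adj_sym[OF uv] mem_neighborhood by blast
qed

lemma (in graph) connected_K2_component:
  assumes "connected G" "neighborhood G u = {v}" "neighborhood G v = {u}"
  shows "complete_digraph 2 G"
proof -
  have uv: "u \<rightarrow>\<^bsub>G\<^esub> v" "v \<rightarrow>\<^bsub>G\<^esub> u"
    using assms(2,3) mem_neighborhood by auto
  then have V: "u \<in> verts G" "v \<in> verts G" "u \<noteq> v"
    using adj_vertsD adj_not_same by blast+
  have "x \<in> {u, v}" if "x \<in> verts G" for x
  proof -
    \<comment> \<open>\<open>connected\<close> speaks of the symmetrized graph; as the arcs are
      already symmetric, it yields directed reachability, which cannot leave
      \<open>{u, v}\<close>.\<close>
    have "u \<rightarrow>\<^sup>*\<^bsub>G\<^esub> x"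
      using symmetric_connected_imp_strongly_connected[OF sym_arcs assms(1)] that V(1)
      by (auto simp: strongly_connected_def)
    then show ?thesis
    proof (induction rule: reachable_induct)
      case base
      show ?case by simp
    next
      case (step x y)
      then have "y \<in> neighborhood G x" "x = u \<or> x = v"
        by (auto simp: mem_neighborhood)
      then show ?case
        using assms(2,3) by auto
    qed
  qed
  then have "verts G = {u, v}"
    using V by auto
  then show ?thesis
    using uv V(3) by (auto simp: complete_digraph_iff clique_def)
qed

section \<open>Partitions into cliques with private vertices\<close>

text \<open>Each part contains at most one vertex of an independent set, hence the size of the partition
  bounds the independence number, with equality for the sets meeting every part.\<close>

lemma (in graph) maximum_independent_set_extend:
  assumes part: "partition_on (verts G) P" and cl: "\<And>T. T \<in> P \<Longrightarrow> clique G T"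
    and f: "\<And>T. T \<in> P \<Longrightarrow> f T \<in> T \<and> neighborhood G (f T) \<subseteq> T"
    and A: "independent_set G A"
  shows "maximum_independent_set G (A \<union> f ` {T \<in> P. A \<inter> T = {}})" (is "maximum_independent_set G ?S")
proof -
  have fin: "finite P"
    using finite_elements[OF finite_verts part] .
  have un: "\<Union>P = verts G"
    using part by (auto simp: partition_on_def)
  have same: "T = T'" if "x \<in> T" "x \<in> T'" "T \<in> P" "T' \<in> P" for x T T'
    using that part unfolding partition_on_def disjoint_def by blast
  have upper: "card I \<le> card P" if I: "independent_set G I" for I
  proof -
    have "\<forall>x\<in>I. \<exists>T\<in>P. x \<in> T"
      using I un unfolding independent_set_def by blast
    then obtain h where h: "\<And>x. x \<in> I \<Longrightarrow> h x \<in> P \<and> x \<in> h x"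
      by metis
    then have "inj_on h I"
      using cl I unfolding inj_on_def independent_set_def clique_def by metis
    then show ?thesis
      using h fin by (intro card_inj_on_le[of h]) auto
  qed
  \<comment> \<open>A neighbour of an added vertex \<open>f T\<close> lies in \<open>T\<close>.
    Since \<open>T\<close> misses \<open>A\<close>, the only member of \<open>?S\<close> in
    \<open>T\<close> is \<open>f T\<close> itself.\<close>
  have no_arc: "\<not> x \<rightarrow>\<^bsub>G\<^esub> y" if "x \<in> ?S" "y \<in> f ` {T \<in> P. A \<inter> T = {}}" for x y
  proof
    assume "x \<rightarrow>\<^bsub>G\<^esub> y"
    obtain T where T: "T \<in> P" "A \<inter> T = {}" "y = f T"
      using \<open>y \<in> f ` _\<close> by blast
    then have "x \<in> T"
      using f[of T] adj_sym[OF \<open>x \<rightarrow>\<^bsub>G\<^esub> y\<close>] by (auto simp: mem_neighborhood)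
    then have "x = y"
      using that(1) T f same by blast
    then show False
      using \<open>x \<rightarrow>\<^bsub>G\<^esub> y\<close> adj_not_same by blast
  qed
  have "f T \<in> verts G" if "T \<in> P" for T
    using f[OF that] that un by blast
  then have "?S \<subseteq> verts G"
    using A unfolding independent_set_def by blast
  moreover have "\<not> x \<rightarrow>\<^bsub>G\<^esub> y" if "x \<in> ?S" "y \<in> ?S" for x y
    using that no_arc[of x y] no_arc[of y x] adj_sym[of x y] A
    unfolding independent_set_def by blast
  ultimately have ind: "independent_set G ?S"
    by (simp add: independent_set_def)
  \<comment> \<open>Every part meets \<open>?S\<close>, in \<open>A\<close> or in the added vertex.
    Choosing one such vertex per part is injective because the parts are disjoint, so
    \<open>?S\<close> attains the bound \<open>upper\<close>.\<close>
  have "\<forall>T\<in>P. \<exists>x\<in>?S. x \<in> T"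
    using f by blast
  then obtain g where g: "\<And>T. T \<in> P \<Longrightarrow> g T \<in> ?S \<and> g T \<in> T"
    by metis
  then have "inj_on g P"
    using same unfolding inj_on_def by metis
  then have "card P \<le> card ?S"
    using g independent_set_finite[OF ind] by (intro card_inj_on_le[of g]) auto
  then show ?thesis
    using ind upper le_trans unfolding maximum_independent_set_def by blast
qed

text \<open>Common core of the \<open>K2\<close> and triangle cases. Two vertices without neighbours
  outside their part leave one for each of the two independent sets to be extended.\<close>

lemma (in graph) W2_if_clique_partition:
  assumes part: "partition_on (verts G) P" and cl: "\<And>T. T \<in> P \<Longrightarrow> clique G T"
    and two: "\<And>T. T \<in> P \<Longrightarrow> \<exists>s\<in>T. \<exists>t\<in>T. s \<noteq> t \<and> neighborhood G s \<subseteq> T \<and> neighborhood G t \<subseteq> T"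
  shows "W2 G"
  unfolding W2_def
proof (intro allI impI, elim conjE)
  fix A B assume A: "independent_set G A" and B: "independent_set G B" and AB: "A \<inter> B = {}"
  obtain s t where st: "\<And>T. T \<in> P \<Longrightarrow> s T \<in> T \<and> t T \<in> T \<and> s T \<noteq> t T \<and>
      neighborhood G (s T) \<subseteq> T \<and> neighborhood G (t T) \<subseteq> T"
    using two by metis
  have not_both: "\<not> (s T \<in> I \<and> t T \<in> I)" if "T \<in> P" "independent_set G I" for T I
    using st[OF that(1)] cl[OF that(1)] that(2) unfolding clique_def independent_set_def by blast
  \<comment> \<open>By default \<open>A\<close> is extended by \<open>s T\<close> and
    \<open>B\<close> by \<open>t T\<close>, switching when the other set already owns that vertex.
    By \<open>not_both\<close> the alternative is then free.\<close>
  define f where "f T = (if s T \<in> B then t T else s T)" for T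
  define g where "g T = (if t T \<in> A then s T else t T)" for T
  let ?S = "A \<union> f ` {T \<in> P. A \<inter> T = {}}" and ?T = "B \<union> g ` {T \<in> P. B \<inter> T = {}}"
  have f: "f T \<in> T \<and> neighborhood G (f T) \<subseteq> T \<and> f T \<notin> B"
    and g: "g T \<in> T \<and> neighborhood G (g T) \<subseteq> T \<and> g T \<notin> A" if "T \<in> P" for T
    using st[OF that] not_both[OF that A] not_both[OF that B] by (auto simp: f_def g_def)
  have "f T \<noteq> g U" if "T \<in> P" "A \<inter> T = {}" "U \<in> P" "B \<inter> U = {}" for T U
  proof
    assume eq: "f T = g U"
    then have "T = U"
      using part that f[of T] g[of U] unfolding partition_on_def disjoint_def by (metis disjoint_iff)
    \<comment> \<open>A part that receives a vertex from both extensions misses \<open>A\<close> and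
      \<open>B\<close>, so neither choice switches.\<close>
    then have "f T = s T" "g U = t T"
      using that st[of T] by (auto simp: f_def g_def)
    then show False
      using eq st[OF that(1)] by simp
  qed
  then have "?S \<inter> ?T = {}"
    using AB f g by blast
  moreover have "maximum_independent_set G ?S" "maximum_independent_set G ?T"
    using maximum_independent_set_extend[OF part cl, of f A] f A
      maximum_independent_set_extend[OF part cl, of g B] g B by blast+
  ultimately show "\<exists>S T. maximum_independent_set G S \<and> maximum_independent_set G T \<and>
      S \<inter> T = {} \<and> A \<subseteq> S \<and> B \<subseteq> T"
    by blast
qed

section \<open>The two directions of the equivalence\<close>

lemma ex_two_if_card_ge_2: "card S \<ge> 2 \<Longrightarrow> \<exists>s\<in>S. \<exists>t\<in>S. s \<noteq> t"
  by (metis card_le_Suc0_iff_eq card.infinite not_less_eq_eq numeral_2_eq_2 zero_le)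

lemma (in graph) W2_if_K2:
  assumes "complete_digraph 2 G"
  shows "W2 G"
proof (rule W2_if_clique_partition[of "{verts G}"])
  have K: "clique G (verts G)" "card (verts G) = 2"
    using assms by (auto simp: complete_digraph_iff)
  then show "partition_on (verts G) {verts G}"
    by (intro partition_on_space) auto
  show "clique G T" if "T \<in> {verts G}" for T
    using that K(1) by simp
  show "\<exists>s\<in>T. \<exists>t\<in>T. s \<noteq> t \<and> neighborhood G s \<subseteq> T \<and> neighborhood G t \<subseteq> T"
    if "T \<in> {verts G}" for T
    using that ex_two_if_card_ge_2[of "verts G"] K(2) by (auto simp: neighborhood_def)
qed

lemma (in graph) W2_if_triangle_partition:
  assumes noC4: "\<not> contains_cycle G 4" and part: "partition_on (verts G) P"
    and tri: "\<And>T. T \<in> P \<Longrightarrow> clique G T \<and> card T = 3 \<and> card {v \<in> T. simplicial G v} \<ge> 2"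
  shows "W2 G"
proof (rule W2_if_clique_partition[OF part])
  show "clique G T" if "T \<in> P" for T
    using tri[OF that] by blast
next
  fix T assume T: "T \<in> P"
  \<comment> \<open>The clique \<open>N[s]\<close> contains the triangle \<open>T\<close> and has at
    most three vertices, so it equals \<open>T\<close>.\<close>
  have priv: "neighborhood G s \<subseteq> T" if "s \<in> T" "simplicial G s" for s
  proof -
    let ?N = "closed_neighborhood G s"
    have N: "clique G ?N"
      using that(2) by (simp add: simplicial_def)
    then have "finite ?N"
      unfolding clique_def using finite_verts finite_subset by blast
    moreover have "T \<subseteq> ?N"
      using tri[OF T] that(1) unfolding clique_def mem_closed_neighborhood subset_iff by metis
    moreover have "card ?N \<le> card T"
      using clique_card_le_3[OF noC4 N] tri[OF T] by simp
    ultimately have "T = ?N"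
      by (rule card_seteq)
    then show ?thesis
      by (auto simp: closed_neighborhood_def)
  qed
  show "\<exists>s\<in>T. \<exists>t\<in>T. s \<noteq> t \<and> neighborhood G s \<subseteq> T \<and> neighborhood G t \<subseteq> T"
    using ex_two_if_card_ge_2[of "{v \<in> T. simplicial G v}"] tri[OF T] priv by blast
qed

lemma (in graph) W2_triangle_partition:
  assumes W2: "W2 G" and noC4: "\<not> contains_cycle G 4" and noC5: "\<not> contains_cycle G 5"
    and conn: "connected G" and notK2: "\<not> complete_digraph 2 G"
  obtains P where "partition_on (verts G) P"
    "\<And>T. T \<in> P \<Longrightarrow> clique G T \<and> card T = 3 \<and> card {v \<in> T. simplicial G v} \<ge> 2"
proof
  let ?P = "closed_neighborhood G ` {s. simplicial G s}"
  show "partition_on (verts G) ?P"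
  proof (rule partition_onI)
    show "\<Union>?P = verts G"
    proof
      show "\<Union>?P \<subseteq> verts G"
        by (auto simp: simplicial_def clique_def)
      show "verts G \<subseteq> \<Union>?P"
      proof
        fix v assume "v \<in> verts G"
        then obtain u where "v \<rightarrow>\<^bsub>G\<^esub> u" "simplicial G u"
          using W2_simplicial_neighbour[OF W2 noC4 noC5] by blast
        then show "v \<in> \<Union>?P"
          using adj_sym by (auto simp: mem_closed_neighborhood)
      qed
    qed
  next
    fix T U assume "T \<in> ?P" "U \<in> ?P" and ne: "T \<noteq> U"
    then obtain s t where st: "simplicial G s" "simplicial G t"
      "T = closed_neighborhood G s" "U = closed_neighborhood G t"
      by auto
    show "disjnt T U"
    proof (rule ccontr)
      assume "\<not> disjnt T U"
      then obtain v where "v \<in> closed_neighborhood G s" "v \<in> closed_neighborhood G t"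
        unfolding disjnt_def st by blast
      \<comment> \<open>The common vertex may be \<open>s\<close> or \<open>t\<close> itself. Those
        cases contradict that \<open>s\<close> and \<open>t\<close> are distinct and nonadjacent;
        otherwise \<open>v\<close> has two nonadjacent simplicial neighbours.\<close>
      then have "v = s \<or> v \<rightarrow>\<^bsub>G\<^esub> s" "v = t \<or> v \<rightarrow>\<^bsub>G\<^esub> t"
        using adj_sym unfolding mem_closed_neighborhood by blast+
      moreover have "\<not> s \<rightarrow>\<^bsub>G\<^esub> t" "\<not> t \<rightarrow>\<^bsub>G\<^esub> s" "s \<noteq> t"
        using simplicial_closed_neighborhood_eq st ne by metis+
      ultimately show False
        using W2_simplicial_neighbours_adjacent[OF W2 st(1,2)] by blast
    qed
  next
    show "{} \<notin> ?P"
      by (auto simp: closed_neighborhood_def)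
  qed
next
  fix T assume "T \<in> closed_neighborhood G ` {s. simplicial G s}"
  then obtain s where s: "simplicial G s" and T: "T = closed_neighborhood G s"
    by auto
  then have cl: "clique G T" and "s \<in> verts G"
    by (auto simp: simplicial_def)
  then have fin: "finite T"
    unfolding clique_def using finite_verts finite_subset by blast
  obtain u where u: "s \<rightarrow>\<^bsub>G\<^esub> u" "simplicial G u"
    using W2_simplicial_neighbour[OF W2 noC4 noC5 \<open>s \<in> verts G\<close>] by blast
  \<comment> \<open>If \<open>u\<close> were the only neighbour of \<open>s\<close>, then
    \<open>s\<close> and \<open>u\<close> would span a component, making \<open>G\<close> a
    \<open>K2\<close>.\<close>
  have "neighborhood G s \<noteq> {u}"
    using W2_leaf[OF W2] connected_K2_component[OF conn] notK2 by blast
  then obtain x where x: "s \<rightarrow>\<^bsub>G\<^esub> x" "x \<noteq> u"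
    using u(1) mem_neighborhood by blast
  have dist: "s \<noteq> u" "s \<noteq> x"
    using u(1) x(1) adj_not_same by blast+
  have memT: "s \<in> T" "u \<in> T" "x \<in> T"
    using u(1) x(1) by (auto simp: T mem_closed_neighborhood)
  \<comment> \<open>Three distinct members meet the upper bound of three for cliques.\<close>
  have "card {s, u, x} \<le> card T"
    using fin memT by (intro card_mono) auto
  then have "card T = 3"
    using clique_card_le_3[OF noC4 cl] dist x(2) by simp
  moreover have "card {s, u} \<le> card {v \<in> T. simplicial G v}"
    using fin s u memT by (intro card_mono) auto
  ultimately show "clique G T \<and> card T = 3 \<and> card {v \<in> T. simplicial G v} \<ge> 2"
    using cl dist by simp
qed

theorem theorem5p8:
  fixes G :: "('a, 'b) pre_digraph"
  assumes "graph G"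
    and "Digraph_Component.connected G"
    and "\<not> contains_cycle G 4"
    and "\<not> contains_cycle G 5"
  shows "W2 G \<longleftrightarrow>
    complete_digraph 2 G \<or>
    (\<exists>P. partition_on (verts G) P \<and>
      (\<forall>T\<in>P. complete_digraph 3 (G \<restriction> T) \<and> card {v \<in> T. simplicial G v} \<ge> 2))"
proof -
  interpret graph G by fact
  have parts: "T \<subseteq> verts G" if "partition_on (verts G) P" "T \<in> P" for P T
    using that by (auto simp: partition_on_def)
  have iff: "(\<forall>T\<in>P. complete_digraph 3 (G \<restriction> T) \<and> card {v \<in> T. simplicial G v} \<ge> 2) \<longleftrightarrow>
      (\<forall>T\<in>P. clique G T \<and> card T = 3 \<and> card {v \<in> T. simplicial G v} \<ge> 2)"
    if "partition_on (verts G) P" for P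
    using complete_digraph_induce_iff[OF parts[OF that]] by auto
  show ?thesis (is "_ \<longleftrightarrow> ?K2 \<or> ?tri")
  proof (intro iffI)
    assume "W2 G"
    show "?K2 \<or> ?tri"
    proof (cases ?K2)
      case False
      obtain P where P: "partition_on (verts G) P"
        "\<And>T. T \<in> P \<Longrightarrow> clique G T \<and> card T = 3 \<and> card {v \<in> T. simplicial G v} \<ge> 2"
        using W2_triangle_partition[OF \<open>W2 G\<close> assms(3,4,2) False] by blast
      then show ?thesis
        using iff[OF P(1)] by blast
    qed simp
  next
    assume "?K2 \<or> ?tri"
    then show "W2 G"
    proof
      assume ?tri
      then obtain P where P: "partition_on (verts G) P"
        "\<forall>T\<in>P. complete_digraph 3 (G \<restriction> T) \<and> card {v \<in> T. simplicial G v} \<ge> 2"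
        by blast
      then show "W2 G"
        using W2_if_triangle_partition[OF assms(3) P(1)] iff[OF P(1)] by blast
    qed (rule W2_if_K2)
  qed
qed

end
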